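(* Let $\sigma>0$ and let $\mathcal{F}$ be the family of probability densities $f$ over $\mathbb{R}$ satisfying: (1) $f$ is symmetric around $0$; (2) $f$ is non-increasing over $[0,\infty)$; (3) $\mathbb{E}_f[X^2]=\int_{\mathbb{R}}x^2f(x)\,dx\le\sigma^2$. Then the minimum of $f(0)$ over $f\in\mathcal{F}$ is attained, and the distribution minimizing $f(0)$ over $\mathcal{F}$ is the uniform distribution $\mathcal{U}(-\sigma\sqrt3,\sigma\sqrt3)$.
   Context: $\mathcal{U}(a,b)$ denotes the uniform distribution on the interval with endpoints $a<b$. Densities are functions defined pointwise, so that $f(0)$ is meaningful. *)

theory Defs
  imports "HOL-Probability.Probability"
begin

definition prob_density :: "(real \<Rightarrow> real) \<Rightarrow> bool" where
  "prob_density f \<longleftrightarrow>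
     f \<in> borel_measurable borel \<and> (\<forall>x. 0 \<le> f x) \<and> (\<integral>\<^sup>+x. ennreal (f x) \<partial>lborel) = 1"

text \<open>The second moment is taken as a nonnegative Lebesgue integral, so that densities with
  infinite second moment are excluded (the Bochner integral would assign them the value 0).\<close>

definition sym_unimodal_densities :: "real \<Rightarrow> (real \<Rightarrow> real) set" where
  "sym_unimodal_densities \<sigma> =
     {f. prob_density f \<and>
         (\<forall>x. f (- x) = f x) \<and>
         antimono_on {0..} f \<and>
         (\<integral>\<^sup>+x. ennreal (x\<^sup>2 * f x) \<partial>lborel) \<le> ennreal (\<sigma>\<^sup>2)}"

text \<open>The pointwise representative of the density of the uniform distribution on the interval
  with endpoints \<open>a < b\<close>; its values at the two endpoints are a convention.\<close>

definition uniform_density :: "real \<Rightarrow> real \<Rightarrow> real \<Rightarrow> real" where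
  "uniform_density a b x = indicator {a..b} x / measure lborel {a..b}"

end

theory Submission
  imports Defs
begin

text \<open>Put \<open>a = \<sigma> \<surd>3\<close> and let \<open>u\<close> be the uniform density on \<open>[-a, a]\<close>, which has height
  \<open>1 / (2 a)\<close> and second moment \<open>a\<^sup>2 / 3 = \<sigma>\<^sup>2\<close>. If an admissible \<open>f\<close> has
  \<open>f 0 \<le> 1 / (2 a)\<close>, then \<open>f \<le> u\<close> on \<open>[-a, a]\<close> and \<open>f \<ge> u\<close> outside, so
  \<open>(x\<^sup>2 - a\<^sup>2) (f x - u x) \<ge> 0\<close> pointwise. As \<open>f\<close> and \<open>u\<close> have the same mass, the integral of
  this product is the difference of the second moments, which is at most \<open>0\<close>. Hence \<open>f = u\<close>
  almost everywhere, which also rules out \<open>f 0 < 1 / (2 a)\<close>.\<close>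

lemma uniform_density_symmetric:
  assumes "a > 0"
  shows "uniform_density (- a) a x = 1 / (2 * a) * indicator {- a..a} x"
  using assms by (simp add: uniform_density_def)

lemma uniform_density_nonneg: "0 \<le> uniform_density a b x"
  by (simp add: uniform_density_def)

lemma borel_measurable_uniform_density [measurable]:
  "uniform_density a b \<in> borel_measurable borel"
  unfolding uniform_density_def [abs_def] by measurable

lemma has_bochner_integral_uniform_density:
  assumes "a > 0"
  shows "has_bochner_integral lborel (uniform_density (- a) a) 1"
proof -
  \<comment> \<open>The endpoint values stay unsimplified: unification with
    \<open>a / (2 * a)\<close> and \<open>(- a) / (2 * a)\<close> then yields the antiderivative
    \<open>\<lambda>x. x / (2 * a)\<close>. The cubes in the second-moment computation serve the
    same purpose.\<close>
  have "has_bochner_integral lborel (\<lambda>x. 1 / (2 * a) * indicator {- a..a} x)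
          (a / (2 * a) - (- a) / (2 * a))"
    by (rule has_bochner_integral_FTC_Icc_real)
       (use assms in \<open>auto intro!: derivative_eq_intros\<close>)
  moreover have "a / (2 * a) - (- a) / (2 * a) = 1"
    using assms by (simp add: field_simps)
  ultimately show ?thesis
    by (subst has_bochner_integral_cong [OF refl uniform_density_symmetric [OF assms] refl]) simp
qed

lemma has_bochner_integral_uniform_density_square:
  assumes "a > 0"
  shows "has_bochner_integral lborel (\<lambda>x. x\<^sup>2 * uniform_density (- a) a x) (a\<^sup>2 / 3)"
proof -
  have int: "has_bochner_integral lborel (\<lambda>x. (x\<^sup>2 * (1 / (2 * a))) * indicator {- a..a} x)
          (a ^ 3 / (6 * a) - (- a) ^ 3 / (6 * a))"
    by (rule has_bochner_integral_FTC_Icc_real)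
       (use assms in \<open>auto intro!: derivative_eq_intros simp: field_simps\<close>)
  have eq: "a ^ 3 / (6 * a) - (- a) ^ 3 / (6 * a) = a\<^sup>2 / 3"
    using assms by (simp add: field_simps power2_eq_square power3_eq_cube)
  show ?thesis
    using int [unfolded eq] assms by (simp add: uniform_density_symmetric mult.assoc)
qed

text \<open>Bridge between the nonnegative integrals defining the family and the signed integrals
  needed for differences.\<close>

lemma nn_integral_has_bochner_integral:
  fixes f :: "'a \<Rightarrow> real"
  assumes "has_bochner_integral M f r" "\<And>x. 0 \<le> f x"
  shows "(\<integral>\<^sup>+x. ennreal (f x) \<partial>M) = ennreal r"
  using assms by (metis AE_I2 has_bochner_integral_iff nn_integral_eq_integral)

lemma uniform_density_in_sym_unimodal_densities:
  assumes "a > 0" "a\<^sup>2 / 3 \<le> \<sigma>\<^sup>2"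
  shows "uniform_density (- a) a \<in> sym_unimodal_densities \<sigma>"
proof -
  have "antimono_on {0..} (uniform_density (- a) a)"
    using assms
    by (auto simp: monotone_on_def uniform_density_symmetric split: split_indicator)
  moreover have "uniform_density (- a) a (- x) = uniform_density (- a) a x" for x
    using assms by (auto simp: uniform_density_symmetric split: split_indicator)
  ultimately show ?thesis
    using assms nn_integral_has_bochner_integral [OF has_bochner_integral_uniform_density]
      nn_integral_has_bochner_integral [OF has_bochner_integral_uniform_density_square]
    by (simp add: sym_unimodal_densities_def prob_density_def uniform_density_nonneg
        ennreal_leI)
qed

lemma sym_unimodal_densities_le_at_0:
  assumes "f \<in> sym_unimodal_densities \<sigma>"
  shows "f x \<le> f 0"
proof -
  have "f \<bar>x\<bar> \<le> f 0"
    using assms unfolding sym_unimodal_densities_def monotone_on_def by auto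
  moreover have "f \<bar>x\<bar> = f x"
    using assms by (cases "x \<ge> 0") (auto simp: sym_unimodal_densities_def)
  ultimately show ?thesis by simp
qed

text \<open>Assuming only an upper bound on \<open>f 0\<close>, rather than minimality, lets this
  serve both the lower bound on \<open>f 0\<close> (by contradiction) and the uniqueness of the
  minimizer.\<close>

lemma AE_eq_uniform_density:
  assumes f: "f \<in> sym_unimodal_densities \<sigma>"
    and a: "a > 0" "\<sigma>\<^sup>2 \<le> a\<^sup>2 / 3"
    and f0: "f 0 \<le> 1 / (2 * a)"
  shows "AE x in lborel. f x = uniform_density (- a) a x"
proof -
  let ?u = "uniform_density (- a) a"
  \<comment> \<open>This expanded form lets the integral be assembled from the masses and second
    moments of \<open>f\<close> and \<open>?u\<close>; the sign is read off the factored form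
    \<open>g_eq\<close>.\<close>
  let ?g = "\<lambda>x. (x\<^sup>2 * f x - x\<^sup>2 * ?u x) - a\<^sup>2 * (f x - ?u x)"
  have meas [measurable]: "f \<in> borel_measurable borel"
    and nonneg: "\<And>x. 0 \<le> f x"
    and mass: "(\<integral>\<^sup>+x. ennreal (f x) \<partial>lborel) = ennreal 1"
    and moment: "(\<integral>\<^sup>+x. ennreal (x\<^sup>2 * f x) \<partial>lborel) \<le> ennreal (\<sigma>\<^sup>2)"
    using f by (auto simp: sym_unimodal_densities_def prob_density_def)
  have int_f: "has_bochner_integral lborel f 1"
    by (rule has_bochner_integral_nn_integral) (use nonneg mass in auto)
  \<comment> \<open>The moment bound makes the nonnegative integral finite, so the second moment is
    a genuine real number \<open>s\<close>.\<close>
  have "integrable lborel (\<lambda>x. x\<^sup>2 * f x)"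
    by (rule integrableI_nonneg) (use nonneg moment in \<open>auto intro: le_less_trans\<close>)
  then obtain s where int_s: "has_bochner_integral lborel (\<lambda>x. x\<^sup>2 * f x) s"
    by (auto simp: has_bochner_integral_iff)
  have "s \<le> \<sigma>\<^sup>2"
    using nn_integral_has_bochner_integral [OF int_s] nonneg moment by simp
  have int_g: "has_bochner_integral lborel ?g ((s - a\<^sup>2 / 3) - a\<^sup>2 * (1 - 1))"
    by (intro has_bochner_integral_diff has_bochner_integral_mult_right int_s int_f
        has_bochner_integral_uniform_density has_bochner_integral_uniform_density_square a)
  have g_eq: "?g x = (x\<^sup>2 - a\<^sup>2) * (f x - ?u x)" for x
    by (simp add: algebra_simps)
  have g_nonneg: "0 \<le> ?g x" for x
  proof (cases "x \<in> {- a..a}")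
    case True
    then have "x\<^sup>2 \<le> a\<^sup>2"
      using a by (simp add: abs_le_square_iff [symmetric] abs_le_iff)
    moreover have "f x \<le> ?u x"
      using True a f0 sym_unimodal_densities_le_at_0 [OF f, of x]
      by (simp add: uniform_density_symmetric)
    ultimately show ?thesis
      unfolding g_eq by (simp add: mult_nonpos_nonpos)
  next
    case False
    then have "a\<^sup>2 \<le> x\<^sup>2"
      using a by (simp add: abs_le_square_iff [symmetric]) linarith
    moreover have "?u x = 0"
      using False a by (simp add: uniform_density_symmetric)
    ultimately show ?thesis
      unfolding g_eq using nonneg by simp
  qed
  have "integral\<^sup>L lborel ?g \<le> 0"
    using int_g \<open>s \<le> \<sigma>\<^sup>2\<close> a by (simp add: has_bochner_integral_iff)
  moreover have "0 \<le> integral\<^sup>L lborel ?g"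
    by (rule integral_nonneg_AE) (use g_nonneg in simp)
  ultimately have "AE x in lborel. ?g x = 0"
    using integral_nonneg_eq_0_iff_AE [of lborel ?g] int_g g_nonneg
    by (simp add: has_bochner_integral_iff)
  \<comment> \<open>At \<open>a\<close> and \<open>- a\<close> the factor
    \<open>x\<^sup>2 - a\<^sup>2\<close> vanishes and gives no information on \<open>f\<close>;
    these two points form a null set.\<close>
  moreover have "AE x in lborel. x \<noteq> a \<and> x \<noteq> - a"
    using AE_lborel_singleton [of a] AE_lborel_singleton [of "- a"] by eventually_elim simp
  ultimately show ?thesis
  proof eventually_elim
    case (elim x)
    then have "x\<^sup>2 \<noteq> a\<^sup>2"
      by (simp add: power2_eq_iff)
    with elim(1) show ?case
      unfolding g_eq by simp
  qed
qed

text \<open>Otherwise \<open>f\<close> would agree almost everywhere with the uniform density, yet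
  lie strictly below it on all of \<open>{- a..a}\<close>, an interval of positive measure.\<close>

lemma sym_unimodal_densities_at_0_ge:
  assumes f: "f \<in> sym_unimodal_densities \<sigma>"
    and a: "a > 0" "\<sigma>\<^sup>2 \<le> a\<^sup>2 / 3"
  shows "1 / (2 * a) \<le> f 0"
proof (rule ccontr)
  assume less: "\<not> 1 / (2 * a) \<le> f 0"
  then have "AE x in lborel. f x = uniform_density (- a) a x"
    using AE_eq_uniform_density [OF f a] by simp
  then have "AE x in lborel. x \<notin> {- a..a}"
  proof eventually_elim
    case (elim x)
    then show ?case
      using less a sym_unimodal_densities_le_at_0 [OF f, of x]
      by (auto simp: uniform_density_symmetric)
  qed
  then have "emeasure lborel {- a..a} = 0"
    by (subst (asm) AE_iff_measurable [of "{- a..a}"]) auto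
  then show False
    using a by simp
qed

lemma density_uniform_density:
  assumes "a < b"
  shows "density lborel (\<lambda>x. ennreal (uniform_density a b x)) = uniform_measure lborel {a..b}"
  unfolding uniform_measure_def uniform_density_def
  by (rule density_cong)
     (use assms in \<open>auto simp: divide_ennreal ennreal_indicator [symmetric] simp del: ennreal_indicator\<close>)

theorem theorem7:
  fixes \<sigma> :: real
  assumes "\<sigma> > 0"
  shows "is_arg_min (\<lambda>f. f 0) (\<lambda>f. f \<in> sym_unimodal_densities \<sigma>)
           (uniform_density (- \<sigma> * sqrt 3) (\<sigma> * sqrt 3)) \<and>
         (\<forall>f. is_arg_min (\<lambda>f. f 0) (\<lambda>f. f \<in> sym_unimodal_densities \<sigma>) f \<longrightarrow>
              density lborel (\<lambda>x. ennreal (f x)) =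
                uniform_measure lborel {- \<sigma> * sqrt 3..\<sigma> * sqrt 3})"
proof -
  define a where "a = \<sigma> * sqrt 3"
  have a: "a > 0" and moment: "a\<^sup>2 / 3 = \<sigma>\<^sup>2"
    using assms by (auto simp: a_def power_mult_distrib)
  have eq: "- \<sigma> * sqrt 3 = - a"
    by (simp add: a_def)
  let ?u = "uniform_density (- a) a"
  have u_in: "?u \<in> sym_unimodal_densities \<sigma>"
    using uniform_density_in_sym_unimodal_densities a moment by simp
  have u0: "?u 0 = 1 / (2 * a)"
    using a by (simp add: uniform_density_symmetric)
  have "is_arg_min (\<lambda>f. f 0) (\<lambda>f. f \<in> sym_unimodal_densities \<sigma>) ?u"
    using u_in sym_unimodal_densities_at_0_ge [OF _ a] moment
    by (auto simp: is_arg_min_def u0 not_less)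
  \<comment> \<open>Uniqueness concerns the distribution: lowering \<open>?u\<close> to
    \<open>0\<close> at both endpoints gives another minimizing function.\<close>
  moreover have "density lborel (\<lambda>x. ennreal (f x)) = uniform_measure lborel {- a..a}"
    if "is_arg_min (\<lambda>f. f 0) (\<lambda>f. f \<in> sym_unimodal_densities \<sigma>) f" for f
  proof -
    have f: "f \<in> sym_unimodal_densities \<sigma>" and "f 0 \<le> 1 / (2 * a)"
      using that u_in u0 by (auto simp: is_arg_min_def not_less)
    then have ae: "AE x in lborel. f x = ?u x"
      using AE_eq_uniform_density [OF f a] moment by simp
    have [measurable]: "f \<in> borel_measurable borel"
      using f by (simp add: sym_unimodal_densities_def prob_density_def)
    have "density lborel (\<lambda>x. ennreal (f x)) = density lborel (\<lambda>x. ennreal (?u x))"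
      by (rule density_cong) (use ae in auto)
    then show ?thesis
      using a by (simp add: density_uniform_density)
  qed
  ultimately show ?thesis
    unfolding eq a_def [symmetric] by blast
qed

end
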